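(* Let $N=2n+1$ and let $\mathbb O_0$ be the regular nilpotent orbit in $\mathfrak{gl}_N$. Then $\mathbb O_0\cap\mathfrak g^{\theta}$ has infinitely many $H$-orbits. In particular, $\mathfrak g^{\theta}_{\mathrm{nil}}$ has infinitely many $H$-orbits.
   Context: $\mathbf k$ is an algebraically closed field of characteristic $2$, $n\ge1$, $N=2n+1$, $G=GL_N$, $\mathfrak g=\mathfrak{gl}_N$. Let $J=\begin{pmatrix}1&0&0\\0&0&1_n\\0&1_n&0\end{pmatrix}$ and let $\theta:G\to G$ be the involution $\theta(g)=J^{-1}({}^tg^{-1})J$, inducing $\theta(x)=J({}^tx)J$ on $\mathfrak g$. $\mathfrak g^\theta=\{x\in\mathfrak g:\theta(x)=x\}$, $\mathfrak g^\theta_{\mathrm{nil}}$ is the set of nilpotent matrices in $\mathfrak g^\theta$, and $H=G^\theta=\{g\in G:\theta(g)=g\}=\left\{\begin{pmatrix}1&0\\0&y\end{pmatrix}: y\in Sp_{2n}\right\}$, where $Sp_{2n}=\{y\in GL_{2n}:{}^tyJ_0y=J_0\}$ with $J_0=\begin{pmatrix}0&1_n\\1_n&0\end{pmatrix}$. $H$ acts on $\mathfrak g^\theta$ by conjugation. The regular nilpotent orbit is the $GL_N$-orbit of nilpotent matrices with a single Jordan block. *)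

theory Defs
  imports
    "Jordan_Normal_Form.Jordan_Normal_Form"
    "HOL-Algebra.Group_Action"
    "HOL-Computational_Algebra.Polynomial"
begin

text \<open>
  Matrices of size \<open>N\<close> are the elements of \<^term>\<open>carrier_mat N N\<close>; the general linear group is the
  unit group of the matrix ring, so that \<open>inv\<^bsub>GL N\<^esub>\<close> is the matrix inverse.
\<close>

definition GL :: "nat \<Rightarrow> 'k::field mat monoid" where
  "GL N = units_of (ring_mat TYPE('k) N ())"

text \<open>The action of \<open>GL N\<close>, and of its subgroups, by conjugation on \<open>N \<times> N\<close> matrices.\<close>

definition conj_mat :: "nat \<Rightarrow> 'k::field mat \<Rightarrow> 'k mat \<Rightarrow> 'k mat" where
  "conj_mat N g x = g * x * inv\<^bsub>GL N\<^esub> g"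

definition J0 :: "nat \<Rightarrow> 'k::field mat" where
  "J0 n = four_block_mat (0\<^sub>m n n) (1\<^sub>m n) (1\<^sub>m n) (0\<^sub>m n n)"

definition J :: "nat \<Rightarrow> 'k::field mat" where
  "J n = four_block_mat (1\<^sub>m 1) (0\<^sub>m 1 (2 * n)) (0\<^sub>m (2 * n) 1) (J0 n)"

definition theta :: "nat \<Rightarrow> 'k::field mat \<Rightarrow> 'k mat" where
  "theta n g = inv\<^bsub>GL (2 * n + 1)\<^esub> (J n) * transpose_mat (inv\<^bsub>GL (2 * n + 1)\<^esub> g) * J n"

text \<open>
  The map induced on the Lie algebra. The general sign is \<open>-1\<close>, which is \<open>1\<close> in characteristic 2,
  the only case in which this map is used.
\<close>

definition dtheta :: "nat \<Rightarrow> 'k::field mat \<Rightarrow> 'k mat" where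
  "dtheta n x = J n * transpose_mat x * J n"

definition H :: "nat \<Rightarrow> 'k::field mat monoid" where
  "H n = (GL (2 * n + 1)) \<lparr>carrier := {g \<in> carrier (GL (2 * n + 1)). theta n g = g}\<rparr>"

definition g_theta :: "nat \<Rightarrow> 'k::field mat set" where
  "g_theta n = {x \<in> carrier_mat (2 * n + 1) (2 * n + 1). dtheta n x = x}"

definition nilpotent_mat :: "nat \<Rightarrow> 'k::field mat \<Rightarrow> bool" where
  "nilpotent_mat N x \<longleftrightarrow> x \<in> carrier_mat N N \<and> (\<exists>m. x ^\<^sub>m m = 0\<^sub>m N N)"

definition g_theta_nil :: "nat \<Rightarrow> 'k::field mat set" where
  "g_theta_nil n = {x \<in> g_theta n. nilpotent_mat (2 * n + 1) x}"

definition regular_nilpotent_orbit :: "nat \<Rightarrow> 'k::field mat set" where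
  "regular_nilpotent_orbit N = orbit (GL N) (conj_mat N) (jordan_block N 0)"

end

theory Submission
  imports Defs
begin

text \<open>
  Let \<open>B(v, w) = v \<bullet> J w\<close>. In characteristic 2 we have \<open>B(v, v) = v\<^sub>0\<^sup>2\<close>, so \<open>H\<close>, the isometry group of \<open>B\<close>,
  preserves the coordinate \<open>v\<^sub>0\<close> and hence fixes the basis vector \<open>e\<^sub>0\<close> representing it. The elements of
  \<open>g_theta n\<close> are the matrices that are self-adjoint for \<open>B\<close>; if such an \<open>x\<close> satisfies \<open>x u = e\<^sub>0 = x v\<close>, then
  \<open>u\<^sub>0 = B(u, x v) = B(x u, v) = v\<^sub>0\<close>. So \<open>u\<^sub>0\<close> is an invariant of the \<open>H\<close>-orbit of \<open>x\<close>.
  In a basis \<open>e\<^sub>0, e\<^sub>1, \<dots>, e\<^sub>n, f\<^sub>1, \<dots>, f\<^sub>n\<close> with \<open>B(e\<^sub>i, f\<^sub>i) = 1\<close>, the matrix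
  \<open>f\<^sub>n \<mapsto> \<dots> \<mapsto> f\<^sub>1 \<mapsto> e\<^sub>0 + b e\<^sub>1\<close>, \<open>e\<^sub>0 \<mapsto> e\<^sub>1 \<mapsto> \<dots> \<mapsto> e\<^sub>n \<mapsto> 0\<close> is self-adjoint and regular nilpotent, and it maps
  \<open>f\<^sub>1 + b e\<^sub>0\<close> to \<open>e\<^sub>0\<close>, so its invariant is \<open>b\<close>, an arbitrary element of the infinite field.
\<close>

section \<open>Infinitude of the field and arithmetic in characteristic 2\<close>

text \<open>Over a finite field, the product of all \<open>[:-a, 1:]\<close> plus 1 would be
  nonconstant and take the value 1 everywhere, so it would have no root.\<close>

lemma infinite_UNIV_alg_closed_field: "infinite (UNIV :: 'k::alg_closed_field set)"
proof
  assume fin: "finite (UNIV :: 'k set)"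
  define q :: "'k poly" where "q = (\<Prod>a\<in>UNIV. [:-a, 1:])"
  have "degree q = card (UNIV :: 'k set)"
    unfolding q_def by (subst degree_prod_eq_sum_degree) auto
  moreover have "card (UNIV :: 'k set) > 0"
    using fin by (simp add: card_gt_0_iff)
  ultimately have "degree (q + 1) > 0"
    by (simp add: degree_add_eq_left)
  then obtain z where "poly (q + 1) z = 0"
    using alg_closed_imp_poly_has_root by blast
  moreover have "poly q z = 0"
    using fin by (auto simp: q_def poly_prod)
  ultimately show False by simp
qed

lemma add_self_CHAR_2:
  assumes "CHAR('a::ring_1) = 2"
  shows "(x::'a) + x = 0"
  using uminus_CHAR_2[OF assms, of x] by (simp add: add_eq_0_iff2)

lemma power2_eq_1_CHAR_2:
  assumes "CHAR('a::idom) = 2" "(x::'a)\<^sup>2 = 1"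
  shows "x = 1"
proof -
  have "x = 1 \<or> x = -1" using assms(2) by (simp add: power2_eq_1_iff)
  moreover have "(-1::'a) = 1"
    by (rule uminus_CHAR_2[OF assms(1)])
  ultimately show ?thesis by auto
qed

section \<open>The general linear group\<close>

lemma group_GL: "group (GL N :: 'k::field mat monoid)"
  unfolding GL_def by (rule monoid.units_group[OF ring.is_monoid[OF ring_mat]])

lemma carrier_GL:
  "carrier (GL N) = Units (ring_mat TYPE('k::field) N ())"
  by (simp add: GL_def units_of_carrier)

lemma GL_simps [simp]: "mult (GL N) = (*)" "one (GL N) = 1\<^sub>m N"
  by (simp_all add: GL_def units_of_mult units_of_one ring_mat_simps)

lemma GL_carrier_mat: "g \<in> carrier (GL N) \<Longrightarrow> g \<in> carrier_mat N N"
  by (auto simp: carrier_GL Units_def ring_mat_simps)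

lemma inv_GL:
  assumes "g \<in> carrier (GL N :: 'k::field mat monoid)"
  shows "inv\<^bsub>GL N\<^esub> g \<in> carrier_mat N N" "g * inv\<^bsub>GL N\<^esub> g = 1\<^sub>m N" "inv\<^bsub>GL N\<^esub> g * g = 1\<^sub>m N"
  using group.inv_closed[OF group_GL assms] group.r_inv[OF group_GL assms]
    group.l_inv[OF group_GL assms] by (simp_all add: GL_carrier_mat)

lemma inv_GL_one: "inv\<^bsub>GL N\<^esub> (1\<^sub>m N) = (1\<^sub>m N :: 'k::field mat)"
  using group.is_monoid[OF group_GL] monoid.inv_one[of "GL N"] by auto

section \<open>The bilinear form\<close>

text \<open>The matrix \<open>J\<close> is the permutation matrix of the involution \<open>swap n\<close>.\<close>

definition swap :: "nat \<Rightarrow> nat \<Rightarrow> nat" where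
  "swap n i = (if i = 0 then 0 else if i \<le> n then i + n else i - n)"

lemma swap_less: "i < 2 * n + 1 \<Longrightarrow> swap n i < 2 * n + 1"
  by (auto simp: swap_def)

lemma swap_swap: "i < 2 * n + 1 \<Longrightarrow> swap n (swap n i) = i"
  by (auto simp: swap_def)

lemma eq_swap_iff:
  assumes "i < 2 * n + 1" "j < 2 * n + 1"
  shows "i = swap n j \<longleftrightarrow> j = swap n i"
  using assms by (auto simp: swap_def)

lemma J_carrier: "J n \<in> carrier_mat (2 * n + 1) (2 * n + 1)"
  by (simp add: J_def J0_def carrier_matI)

text \<open>The simplifier turns \<open>2 * n + 1\<close> into \<open>Suc (2 * n)\<close>, so the
  simp rule has to be stated in that form.\<close>

lemmas J_carrier_Suc [simp] = J_carrier[simplified]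

lemma J_index:
  assumes "i < 2 * n + 1" "j < 2 * n + 1"
  shows "J n $$ (i, j) = (if i = swap n j then 1 else 0 :: 'k::field)"
proof -
  have J0: "J0 n $$ (k, l) = (if k = l + n \<or> l = k + n then 1 else 0 :: 'k)" if "k < 2 * n" "l < 2 * n" for k l
    using that by (auto simp: J0_def)
  have "dim_row (J0 n :: 'k mat) = 2 * n" "dim_col (J0 n :: 'k mat) = 2 * n"
    by (simp_all add: J0_def)
  then have "J n $$ (i, j) = (if i = 0 then if j = 0 then 1 else 0
      else if j = 0 then 0 else J0 n $$ (i - 1, j - 1) :: 'k)"
    using assms by (simp add: J_def)
  also have "\<dots> = (if i = swap n j then 1 else 0)"
  proof (cases "i = 0 \<or> j = 0")
    case True
    then show ?thesis using assms by (auto simp: swap_def)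
  next
    case False
    then have "i - 1 = j - 1 + n \<or> j - 1 = i - 1 + n \<longleftrightarrow> i = swap n j"
      using assms by (auto simp: swap_def)
    moreover have "i - 1 < 2 * n" "j - 1 < 2 * n" using False assms by auto
    ultimately show ?thesis using False J0[of "i - 1" "j - 1"] by simp
  qed
  finally show ?thesis .
qed

lemma transpose_J: "transpose_mat (J n :: 'k::field mat) = J n"
proof (intro eq_matI)
  fix i j assume "i < dim_row (J n :: 'k mat)" "j < dim_col (J n :: 'k mat)"
  then have ij: "i < 2 * n + 1" "j < 2 * n + 1" by (simp_all add: carrier_matD[OF J_carrier])
  then show "transpose_mat (J n) $$ (i, j) = (J n :: 'k mat) $$ (i, j)"
    using eq_swap_iff[OF ij] by (simp add: J_index carrier_matD[OF J_carrier])
qed (simp_all add: carrier_matD[OF J_carrier])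

lemma J_mult_vec_index:
  assumes "v \<in> carrier_vec (2 * n + 1)" "i < 2 * n + 1"
  shows "(J n *\<^sub>v v) $ i = (v $ swap n i :: 'k::field)"
proof -
  have "(J n *\<^sub>v v) $ i = (\<Sum>k<2 * n + 1. J n $$ (i, k) * v $ k)"
    using assms by (simp add: scalar_prod_def carrier_matD[OF J_carrier] atLeast0LessThan carrier_vecD)
  also have "\<dots> = (\<Sum>k<2 * n + 1. if k = swap n i then v $ k else 0)"
    using assms(2) eq_swap_iff[OF assms(2)] by (intro sum.cong) (auto simp: J_index)
  also have "\<dots> = v $ swap n i"
    using swap_less[OF assms(2)] by simp
  finally show ?thesis .
qed

lemma J_mult_J: "J n * J n = (1\<^sub>m (2 * n + 1) :: 'k::field mat)"
proof (intro eq_matI)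
  fix i j assume "i < dim_row (1\<^sub>m (2 * n + 1) :: 'k mat)" "j < dim_col (1\<^sub>m (2 * n + 1) :: 'k mat)"
  then have ij: "i < 2 * n + 1" "j < 2 * n + 1" by auto
  then have "(J n * J n :: 'k mat) $$ (i, j) = (J n *\<^sub>v col (J n) j) $ i"
    by (simp add: carrier_matD[OF J_carrier])
  also have "\<dots> = J n $$ (swap n i, j)"
    using ij swap_less[OF ij(1)]
    by (subst J_mult_vec_index) (auto simp: carrier_matD[OF J_carrier] carrier_vecI)
  also have "\<dots> = 1\<^sub>m (2 * n + 1) $$ (i, j)"
  proof -
    have "swap n i = swap n j \<longleftrightarrow> i = j" using swap_swap[OF ij(1)] swap_swap[OF ij(2)] by metis
    then show ?thesis using ij swap_less[OF ij(1)] by (simp add: J_index)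
  qed
  finally show "(J n * J n :: 'k mat) $$ (i, j) = 1\<^sub>m (2 * n + 1) $$ (i, j)" .
qed (simp_all add: carrier_matD[OF J_carrier])

lemma J_in_GL: "J n \<in> carrier (GL (2 * n + 1) :: 'k::field mat monoid)"
  using J_mult_J[of n, where 'k = 'k] J_carrier_Suc unfolding carrier_GL Units_def
  by (auto simp: ring_mat_simps)

lemma inv_J: "inv\<^bsub>GL (2 * n + 1)\<^esub> (J n) = (J n :: 'k::field mat)"
  by (rule group.inv_equality[OF group_GL]) (simp_all add: J_mult_J[simplified] J_in_GL[simplified])

text \<open>In characteristic 2 the off-diagonal terms of the symmetric form cancel in pairs.\<close>

lemma scalar_prod_J_CHAR_2:
  assumes "CHAR('k::field) = 2" "v \<in> carrier_vec (2 * n + 1)"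
  shows "v \<bullet> (J n *\<^sub>v v) = (v $ 0 :: 'k)\<^sup>2"
proof -
  define f where "f i = v $ i * v $ swap n i" for i
  have split: "{..<2 * n + 1} = insert 0 ({1..n} \<union> {1 + n..n + n})"
    by auto
  have "v \<bullet> (J n *\<^sub>v v) = (\<Sum>i<2 * n + 1. f i)"
    using assms(2) by (simp add: scalar_prod_def f_def J_mult_vec_index carrier_matD[OF J_carrier]
      atLeast0LessThan del: index_mult_mat_vec)
  also have "\<dots> = f 0 + (\<Sum>i\<in>{1..n} \<union> {1 + n..n + n}. f i)"
    unfolding split by (subst sum.insert) auto
  also have "(\<Sum>i\<in>{1..n} \<union> {1 + n..n + n}. f i) = (\<Sum>i=1..n. f i) + (\<Sum>i=1..n. f (i + n))"
    unfolding sum.shift_bounds_cl_nat_ivl[symmetric] by (rule sum.union_disjoint) auto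
  also have "(\<Sum>i=1..n. f (i + n)) = (\<Sum>i=1..n. f i)"
    by (intro sum.cong) (auto simp: f_def swap_def)
  finally show ?thesis
    using add_self_CHAR_2[OF assms(1)] by (simp add: f_def swap_def power2_eq_square)
qed

section \<open>The orthogonal group fixes the first basis vector\<close>

lemma carrier_H: "carrier (H n) = {g \<in> carrier (GL (2 * n + 1)). theta n g = g}"
  by (simp add: H_def)

text \<open>Used to place a matrix in its own \<open>H n\<close>-orbit.\<close>

lemma one_in_H: "1\<^sub>m (2 * n + 1) \<in> carrier (H n :: 'k::field mat monoid)"
proof -
  have "1\<^sub>m (2 * n + 1) \<in> carrier (GL (2 * n + 1) :: 'k mat monoid)"
    using group.is_monoid[OF group_GL] monoid.one_closed[of "GL (2 * n + 1)"] by auto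
  then show ?thesis
    by (simp add: carrier_H inv_GL_one theta_def inv_J[simplified] J_mult_J[simplified]
        right_mult_one_mat[OF J_carrier_Suc])
qed

text \<open>With \<open>h\<close> the inverse of \<open>g\<close>, the fixed-point equation says
  that \<open>g\<close> is \<open>J n\<close> times the transpose of \<open>h\<close> times
  \<open>J n\<close>. Multiply on the left by \<open>J n\<close>, then by the transpose of
  \<open>g\<close>, which cancels the transpose of \<open>h\<close>.\<close>

lemma H_preserves_form:
  fixes g :: "'k::field mat"
  assumes "g \<in> carrier (H n)"
  shows "transpose_mat g * (J n * g) = J n"
proof -
  let ?N = "2 * n + 1"
  define h where "h = inv\<^bsub>GL ?N\<^esub> g"
  have g: "g \<in> carrier (GL ?N)" and th: "theta n g = g" using assms by (auto simp: carrier_H)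
  note gh = GL_carrier_mat[OF g] inv_GL(1)[OF g, folded h_def]
  have gt: "transpose_mat g \<in> carrier_mat ?N ?N" and ht: "transpose_mat h \<in> carrier_mat ?N ?N"
    using gh by simp_all
  note htJ = mult_carrier_mat[OF ht J_carrier]
  have "J n * g = J n * (J n * (transpose_mat h * J n))"
    using th assoc_mult_mat[OF J_carrier ht J_carrier] by (simp only: theta_def inv_J h_def[symmetric])
  also have "\<dots> = (J n * J n) * (transpose_mat h * J n)"
    using assoc_mult_mat[OF J_carrier J_carrier htJ] ..
  also have "\<dots> = transpose_mat h * J n"
    unfolding J_mult_J by (rule left_mult_one_mat[OF htJ])
  finally have "transpose_mat g * (J n * g) = transpose_mat g * transpose_mat h * J n"
    using assoc_mult_mat[OF gt ht J_carrier] by simp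
  also have "transpose_mat g * transpose_mat h = 1\<^sub>m ?N"
    using transpose_mult[OF gh(2,1)] inv_GL(3)[OF g] by (simp add: h_def transpose_one)
  finally show ?thesis by (simp only: left_mult_one_mat[OF J_carrier])
qed

text \<open>The diagonal entry at \<open>j\<close> of the preserved Gram matrix is B(g e_j, g e_j),
  which is the square of \<open>g $$ (0, j)\<close>. It equals 1 for \<open>j = 0\<close> and 0
  otherwise, and 1 has only one square root in characteristic 2.\<close>

lemma row_0_H:
  fixes g :: "'k::field mat"
  assumes "CHAR('k) = 2" "g \<in> carrier (H n)"
  shows "row g 0 = unit_vec (2 * n + 1) 0"
proof -
  let ?N = "2 * n + 1"
  have g: "g \<in> carrier_mat ?N ?N" using assms(2) by (auto simp: carrier_H GL_carrier_mat)
  show ?thesis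
  proof (rule eq_vecI)
    fix j assume "j < dim_vec (unit_vec ?N 0 :: 'k vec)"
    then have j: "j < ?N" by simp
    have cj: "col g j \<in> carrier_vec ?N" using g by (simp add: carrier_vecI)
    have "(g $$ (0, j))\<^sup>2 = col g j \<bullet> (J n *\<^sub>v col g j)"
      using scalar_prod_J_CHAR_2[OF assms(1) cj] g j by simp
    also have "\<dots> = (transpose_mat g * (J n * g)) $$ (j, j)"
      using g j by (simp add: col_mult2[OF J_carrier g])
    also have "\<dots> = J n $$ (j, j)" by (simp only: H_preserves_form[OF assms(2)])
    also have "\<dots> = (if j = 0 then 1 else 0)" using j by (auto simp: J_index swap_def)
    finally have "g $$ (0, j) = (if j = 0 then 1 else 0)"
      using power2_eq_1_CHAR_2[OF assms(1)] by (cases "j = 0") simp_all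
    then show "row g 0 $ j = unit_vec ?N 0 $ j" using g j by simp
  next
    show "dim_vec (row g 0) = dim_vec (unit_vec ?N 0 :: 'k vec)" using g by simp
  qed
qed

lemma H_mult_vec_index_0:
  fixes g :: "'k::field mat"
  assumes "CHAR('k) = 2" "g \<in> carrier (H n)" "v \<in> carrier_vec (2 * n + 1)"
  shows "(g *\<^sub>v v) $ 0 = v $ 0"
proof -
  have "g \<in> carrier (GL (2 * n + 1))" using assms(2) by (simp add: carrier_H)
  then have "dim_row g = 2 * n + 1" using GL_carrier_mat carrier_matD(1) by blast
  then have "(g *\<^sub>v v) $ 0 = row g 0 \<bullet> v" by simp
  then show ?thesis using assms(3) by (simp add: row_0_H[OF assms(1,2), simplified])
qed

lemma J_mult_unit_vec_0: "J n *\<^sub>v unit_vec (2 * n + 1) 0 = (unit_vec (2 * n + 1) 0 :: 'k::field vec)"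
proof (intro eq_vecI)
  fix i assume "i < dim_vec (unit_vec (2 * n + 1) 0 :: 'k vec)"
  then have i: "i < 2 * n + 1" by simp
  show "(J n *\<^sub>v unit_vec (2 * n + 1) 0) $ i = (unit_vec (2 * n + 1) 0 :: 'k vec) $ i"
    using i swap_less[OF i] by (subst J_mult_vec_index) (auto simp: swap_def)
qed (simp add: carrier_matD[OF J_carrier])

text \<open>The row computed above says that the transpose of \<open>g\<close> fixes e_0. Applying
  the preserved form to e_0, which \<open>J n\<close> also fixes, and cancelling the transpose of
  \<open>g\<close> and then \<open>J n\<close> carries this over to \<open>g\<close>.\<close>

lemma H_mult_unit_vec_0:
  fixes g :: "'k::field mat"
  assumes "CHAR('k) = 2" "g \<in> carrier (H n)"
  shows "g *\<^sub>v unit_vec (2 * n + 1) 0 = unit_vec (2 * n + 1) 0"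
proof -
  let ?N = "2 * n + 1" and ?e = "unit_vec (2 * n + 1) 0 :: 'k vec"
  have gl: "g \<in> carrier (GL ?N)" using assms(2) by (auto simp: carrier_H)
  note g = GL_carrier_mat[OF gl]
  have gt: "transpose_mat g \<in> carrier_mat ?N ?N" using g by simp
  have e: "?e \<in> carrier_vec ?N" by simp
  have ge: "g *\<^sub>v ?e \<in> carrier_vec ?N" using g by (rule mult_mat_vec_carrier) simp
  have tge: "transpose_mat g *\<^sub>v ?e = ?e"
  proof (intro eq_vecI)
    fix i assume "i < dim_vec ?e"
    then have i: "i < ?N" by simp
    have "(transpose_mat g *\<^sub>v ?e) $ i = row g 0 $ i" using g i by simp
    then show "(transpose_mat g *\<^sub>v ?e) $ i = ?e $ i" by (simp only: row_0_H[OF assms])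
  qed (use g in simp)
  have "transpose_mat g *\<^sub>v (J n *\<^sub>v (g *\<^sub>v ?e)) = (transpose_mat g * (J n * g)) *\<^sub>v ?e"
    using assoc_mult_mat_vec[OF gt mult_carrier_mat[OF J_carrier g] e]
      assoc_mult_mat_vec[OF J_carrier g e] by simp
  also have "\<dots> = transpose_mat g *\<^sub>v ?e"
    by (simp only: H_preserves_form[OF assms(2)] J_mult_unit_vec_0 tge)
  finally have eq: "transpose_mat g *\<^sub>v (J n *\<^sub>v (g *\<^sub>v ?e)) = transpose_mat g *\<^sub>v ?e" .
  define h where "h = transpose_mat (inv\<^bsub>GL ?N\<^esub> g)"
  have h: "h \<in> carrier_mat ?N ?N" "h * transpose_mat g = 1\<^sub>m ?N"
    using inv_GL[OF gl] transpose_mult[OF g inv_GL(1)[OF gl]] by (auto simp: h_def transpose_one)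
  have cancel: "h *\<^sub>v (transpose_mat g *\<^sub>v w) = w" if "w \<in> carrier_vec ?N" for w
    using assoc_mult_mat_vec[OF h(1) gt that] h(2) that by simp
  have "J n *\<^sub>v (g *\<^sub>v ?e) = ?e"
    using arg_cong[OF eq, of "(*\<^sub>v) h"] cancel[OF e] cancel[OF mult_mat_vec_carrier[OF J_carrier ge]]
    by simp
  then have "J n *\<^sub>v (J n *\<^sub>v (g *\<^sub>v ?e)) = ?e" by (simp only: J_mult_unit_vec_0)
  then show ?thesis using assoc_mult_mat_vec[OF J_carrier J_carrier ge] ge by (simp only: J_mult_J one_mult_mat_vec)
qed

section \<open>An invariant\<close>

lemma first_coordinate_of_preimage_unique:
  fixes x :: "'k::field mat"
  assumes x: "x \<in> g_theta n"
    and u: "u \<in> carrier_vec (2 * n + 1)" "x *\<^sub>v u = unit_vec (2 * n + 1) 0"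
    and v: "v \<in> carrier_vec (2 * n + 1)" "x *\<^sub>v v = unit_vec (2 * n + 1) 0"
  shows "u $ 0 = v $ 0"
proof -
  let ?N = "2 * n + 1"
  have xc: "x \<in> carrier_mat ?N ?N" and dx: "dtheta n x = x" using x by (auto simp: g_theta_def)
  have xt: "transpose_mat x \<in> carrier_mat ?N ?N" using xc by simp
  have xtJ: "transpose_mat x * J n \<in> carrier_mat ?N ?N" using mult_carrier_mat[OF xt J_carrier] .
  \<comment> \<open>Since \<open>J n\<close> squares to 1, being fixed by \<open>dtheta n\<close>
    amounts to self-adjointness for B.\<close>
  have "J n * x = J n * (J n * (transpose_mat x * J n))"
    using dx assoc_mult_mat[OF J_carrier xt J_carrier] by (simp add: dtheta_def)
  also have "\<dots> = transpose_mat x * J n"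
    using assoc_mult_mat[OF J_carrier J_carrier xtJ] left_mult_one_mat[OF xtJ] by (simp only: J_mult_J)
  finally have self_adj: "J n * x = transpose_mat x * J n" .
  have Ju: "J n *\<^sub>v u \<in> carrier_vec ?N" using mult_mat_vec_carrier[OF J_carrier u(1)] .
  have "u $ 0 = (J n *\<^sub>v u) $ 0" using J_mult_vec_index[OF u(1), of 0] by (simp add: swap_def)
  also have "\<dots> = (x *\<^sub>v v) \<bullet> (J n *\<^sub>v u)" using Ju by (simp add: v(2))
  also have "\<dots> = (J n *\<^sub>v u) \<bullet> (x *\<^sub>v v)" using Ju v(2) by (intro comm_scalar_prod[of _ ?N]) auto
  also have "\<dots> = (transpose_mat x *\<^sub>v (J n *\<^sub>v u)) \<bullet> v"
    using transpose_vec_mult_scalar[OF xc v(1) Ju] by simp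
  also have "transpose_mat x *\<^sub>v (J n *\<^sub>v u) = J n *\<^sub>v (x *\<^sub>v u)"
    using assoc_mult_mat_vec[OF xt J_carrier u(1)] assoc_mult_mat_vec[OF J_carrier xc u(1)]
    by (simp add: self_adj)
  also have "\<dots> = unit_vec ?N 0" by (simp only: u(2) J_mult_unit_vec_0)
  also have "unit_vec ?N 0 \<bullet> v = v $ 0" using v(1) by simp
  finally show ?thesis .
qed

text \<open>Because \<open>g\<close> fixes e_0, it carries a preimage \<open>u\<close> of e_0 under
  \<open>x\<close> to one under \<open>y\<close>. It keeps the first coordinate of \<open>u\<close>,
  and uniqueness for \<open>y\<close> gives the comparison with \<open>v\<close>.\<close>

lemma first_coordinate_of_preimage_invariant:
  fixes x y g :: "'k::field mat"
  assumes "CHAR('k) = 2" "g \<in> carrier (H n)"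
    and x: "x \<in> carrier_mat (2 * n + 1) (2 * n + 1)"
    and y: "y \<in> g_theta n" "y = conj_mat (2 * n + 1) g x"
    and u: "u \<in> carrier_vec (2 * n + 1)" "x *\<^sub>v u = unit_vec (2 * n + 1) 0"
    and v: "v \<in> carrier_vec (2 * n + 1)" "y *\<^sub>v v = unit_vec (2 * n + 1) 0"
  shows "u $ 0 = v $ 0"
proof -
  let ?N = "2 * n + 1"
  have gl: "g \<in> carrier (GL ?N)" using assms(2) by (auto simp: carrier_H)
  note g = GL_carrier_mat[OF gl] and h = inv_GL[OF gl]
  have gx: "g * x \<in> carrier_mat ?N ?N" using mult_carrier_mat[OF g x] .
  have gu: "g *\<^sub>v u \<in> carrier_vec ?N" using mult_mat_vec_carrier[OF g u(1)] .
  have "y *\<^sub>v (g *\<^sub>v u) = g * x *\<^sub>v (inv\<^bsub>GL ?N\<^esub> g *\<^sub>v (g *\<^sub>v u))"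
    unfolding y(2) conj_mat_def using assoc_mult_mat_vec[OF gx h(1) gu] .
  also have "inv\<^bsub>GL ?N\<^esub> g *\<^sub>v (g *\<^sub>v u) = u"
    using assoc_mult_mat_vec[OF h(1) g u(1)] h(3) u(1) by simp
  also have "g * x *\<^sub>v u = unit_vec ?N 0"
    using assoc_mult_mat_vec[OF g x u(1)] H_mult_unit_vec_0[OF assms(1,2)] by (simp add: u(2))
  finally have "(g *\<^sub>v u) $ 0 = v $ 0"
    using first_coordinate_of_preimage_unique[OF y(1) gu _ v] by blast
  then show ?thesis using H_mult_vec_index_0[OF assms(1,2) u(1)] by simp
qed

section \<open>A one-parameter family of regular nilpotent matrices\<close>

text \<open>Index \<open>0 \<le> i \<le> n\<close> stands for \<open>e\<^sub>i\<close> and index \<open>n + i\<close>, \<open>1 \<le> i \<le> n\<close>, for \<open>f\<^sub>i\<close>.\<close>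

definition reg_nilp :: "nat \<Rightarrow> 'k::field \<Rightarrow> 'k mat" where
  "reg_nilp n b = mat (2 * n + 1) (2 * n + 1) (\<lambda>(i, j).
     if j < n then (if i = j + 1 then 1 else 0)
     else if j = n then 0
     else if j = n + 1 then (if i = 0 then 1 else if i = 1 then b else 0)
     else (if i = j - 1 then 1 else 0))"

text \<open>The columns are \<open>x\<^sup>2\<^sup>n f\<^sub>n, \<dots>, x f\<^sub>n, f\<^sub>n\<close> for \<open>x = reg_nilp n b\<close>.\<close>

definition jordan_basis :: "nat \<Rightarrow> 'k::field \<Rightarrow> 'k mat" where
  "jordan_basis n b = mat (2 * n + 1) (2 * n + 1) (\<lambda>(i, j).
     if j \<le> n then (if i + j = n then 1 else if i + j = n + 1 \<and> j \<ge> 1 then b else 0)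
     else (if i = j then 1 else 0))"

lemma reg_nilp_carrier: "reg_nilp n b \<in> carrier_mat (2 * n + 1) (2 * n + 1)"
  by (simp add: reg_nilp_def)

lemmas reg_nilp_carrier_Suc [simp] = reg_nilp_carrier[simplified]

lemma jordan_basis_carrier: "jordan_basis n b \<in> carrier_mat (2 * n + 1) (2 * n + 1)"
  by (simp add: jordan_basis_def)

text \<open>Conjugating the transpose by the permutation matrix \<open>J n\<close> moves the entry
  at \<open>(swap n j, swap n i)\<close> to \<open>(i, j)\<close>. The claim is thus a symmetry of
  the pattern of entries.\<close>

lemma reg_nilp_in_g_theta:
  assumes "n \<ge> 1"
  shows "reg_nilp n (b :: 'k::field) \<in> g_theta n"
proof -
  let ?N = "2 * n + 1" and ?x = "reg_nilp n b"
  have "dtheta n ?x = ?x"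
  proof (intro eq_matI)
    fix i j assume "i < dim_row ?x" "j < dim_col ?x"
    then have ij: "i < ?N" "j < ?N" by (auto simp: reg_nilp_def)
    have Jx: "J n * transpose_mat ?x \<in> carrier_mat ?N ?N"
      by (intro mult_carrier_mat[OF J_carrier]) simp
    \<comment> \<open>Symmetry of \<open>J n\<close> turns right multiplication by it into its
      action on a row vector, so \<open>J_mult_vec_index\<close> applies on both sides.\<close>
    have "col (J n) j = row (J n :: 'k mat) j"
      using ij by (metis transpose_J row_transpose carrier_matD(2) J_carrier)
    moreover have "row (J n * transpose_mat ?x) i \<in> carrier_vec ?N"
      using row_carrier_vec[OF ij(1) Jx] .
    moreover have "row (J n :: 'k mat) j \<in> carrier_vec ?N" using row_carrier_vec[OF ij(2) J_carrier] .
    ultimately have "dtheta n ?x $$ (i, j) = (J n *\<^sub>v row (J n * transpose_mat ?x) i) $ j"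
      using ij Jx comm_scalar_prod[of "row (J n * transpose_mat ?x) i" ?N "row (J n) j"]
      by (simp add: dtheta_def carrier_matD[OF J_carrier])
    also have "\<dots> = (J n * transpose_mat ?x) $$ (i, swap n j)"
      using ij Jx swap_less[OF ij(2)] by (subst J_mult_vec_index)
        (simp_all add: row_carrier_vec[OF ij(1) Jx, simplified] index_row(1) carrier_matD[OF Jx, simplified]
          carrier_matD[OF J_carrier] carrier_matD[OF reg_nilp_carrier] del: index_mult_mat(1))
    also have "\<dots> = (J n *\<^sub>v row ?x (swap n j)) $ i"
      using ij swap_less[OF ij(2)]
      by (simp add: carrier_matD[OF J_carrier] carrier_matD[OF reg_nilp_carrier])
    also have "\<dots> = ?x $$ (swap n j, swap n i)"
      using ij swap_less[OF ij(1)] swap_less[OF ij(2)]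
      by (subst J_mult_vec_index)
        (simp_all add: row_carrier_vec[OF _ reg_nilp_carrier, simplified] carrier_matD[OF reg_nilp_carrier])
    also have "\<dots> = ?x $$ (i, j)"
    proof -
      \<comment> \<open>\<open>P\<close> marks the entries 1 and \<open>Q\<close> the entry
        \<open>b\<close>. The reflection maps \<open>Q\<close> to itself and pairs, for instance,
        f_1 \<mapsto> e_0 with e_0 \<mapsto> e_1.\<close>
      define P where "P k l \<longleftrightarrow> l < n \<and> k = l + 1 \<or> l = n + 1 \<and> k = 0 \<or> n + 1 < l \<and> k + 1 = l" for k l
      define Q where "Q k l \<longleftrightarrow> l = n + 1 \<and> k = 1" for k l :: nat
      have entry: "?x $$ (k, l) = (if P k l then 1 else if Q k l then b else 0)"
        if "k < ?N" "l < ?N" for k l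
      proof -
        have "k + 1 = l \<longleftrightarrow> k = l - 1" if "n + 1 < l" using that by linarith
        then show ?thesis using that by (simp add: reg_nilp_def P_def Q_def)
      qed
      have "P (swap n j) (swap n i) \<longleftrightarrow> P i j"
        unfolding P_def swap_def using ij assms
        by (cases "i = 0"; cases "j = 0"; cases "i \<le> n"; cases "j \<le> n") (simp_all, linarith+)
      moreover have "Q (swap n j) (swap n i) \<longleftrightarrow> Q i j"
        unfolding Q_def swap_def using ij assms
        by (cases "i = 0"; cases "j = 0"; cases "i \<le> n"; cases "j \<le> n") (simp_all, linarith+)
      ultimately show ?thesis
        using entry[OF ij] entry[OF swap_less[OF ij(2)] swap_less[OF ij(1)]] by simp
    qed
    finally show "dtheta n ?x $$ (i, j) = ?x $$ (i, j)" .
  qed (auto simp: dtheta_def carrier_matD[OF J_carrier] reg_nilp_def)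
  then show ?thesis by (simp add: g_theta_def)
qed

lemma jordan_basis_in_GL: "(jordan_basis n b :: 'k::field mat) \<in> carrier (GL (2 * n + 1))"
proof -
  let ?N = "2 * n + 1" and ?g = "jordan_basis n b"
  \<comment> \<open>Reversing the first \<open>n + 1\<close> rows makes the matrix upper unitriangular.\<close>
  define p where "p i = (if i \<le> n then n - i else i)" for i
  define U where "U = mat ?N ?N (\<lambda>(i, j). ?g $$ (p i, j))"
  have p: "p permutes {0..<?N}"
    by (rule bij_imp_permutes, rule bij_betw_byWitness[where f' = p]) (auto simp: p_def)
  have "upper_triangular U"
    by (rule upper_triangularI) (auto simp: U_def jordan_basis_def p_def)
  moreover have "U \<in> carrier_mat ?N ?N" by (simp add: U_def)
  moreover have "diag_mat U = replicate ?N 1"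
    unfolding list_eq_iff_nth_eq by (auto simp: diag_mat_def U_def jordan_basis_def p_def simp del: upt_Suc replicate_Suc)
  ultimately have "det U = 1" using det_upper_triangular by fastforce
  then have "det ?g \<noteq> 0"
    using det_permute_rows[OF jordan_basis_carrier p, of b] by (auto simp: U_def)
  then show ?thesis
    using det_non_zero_imp_unit[OF jordan_basis_carrier] by (simp add: carrier_GL)
qed

text \<open>Right multiplication by the Jordan block shifts columns one place to the right. So
  \<open>reg_nilp n b\<close> must kill column 0 of the basis and send column \<open>j\<close> to
  column \<open>j - 1\<close>.\<close>

lemma reg_nilp_mult_jordan_basis:
  assumes "n \<ge> 1"
  shows "reg_nilp n b * jordan_basis n b = jordan_basis n b * jordan_block (2 * n + 1) (0 :: 'k::field)"
proof (intro eq_matI)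
  let ?N = "2 * n + 1" and ?g = "jordan_basis n b" and ?x = "reg_nilp n b"
  fix i j assume "i < dim_row (?g * jordan_block ?N 0)" "j < dim_col (?g * jordan_block ?N 0)"
  then have ij: "i < ?N" "j < ?N" by (auto simp: jordan_basis_def)
  have "(?x * ?g) $$ (i, j) = (\<Sum>k<?N. ?x $$ (i, k) * ?g $$ (k, j))"
    using ij by (simp add: scalar_prod_def carrier_matD[OF reg_nilp_carrier]
        carrier_matD[OF jordan_basis_carrier] atLeast0LessThan)
  also have "\<dots> = (if j = 0 then 0 else ?g $$ (i, j - 1))"
  proof -
    consider "j = 0" | "1 \<le> j" "j \<le> n" | "n < j" by linarith
    then show ?thesis
    proof cases
      case 1
      then have "(\<Sum>k<?N. ?x $$ (i, k) * ?g $$ (k, j)) = (\<Sum>k<?N. if k = n then ?x $$ (i, k) else 0)"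
        by (intro sum.cong) (simp_all add: jordan_basis_def)
      then show ?thesis using 1 ij by (simp add: reg_nilp_def)
    next
      case 2
      have "?g $$ (k, j) = (if k = n - j then 1 else 0) + (if k = n + 1 - j then b else 0)" if "k < ?N" for k
      proof -
        have "k + j = n \<longleftrightarrow> k = n - j" "k + j = n + 1 \<longleftrightarrow> k = n + 1 - j" "n - j \<noteq> n + 1 - j"
          using 2 by linarith+
        then show ?thesis using 2 ij that by (simp add: jordan_basis_def)
      qed
      then have "(\<Sum>k<?N. ?x $$ (i, k) * ?g $$ (k, j)) = (\<Sum>k<?N.
          (if k = n - j then ?x $$ (i, k) else 0) + (if k = n + 1 - j then ?x $$ (i, k) * b else 0))"
        by (intro sum.cong) (simp_all add: distrib_left)
      also have "\<dots> = ?x $$ (i, n - j) + ?x $$ (i, n + 1 - j) * b"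
      proof -
        have "n - j < ?N" "n + 1 - j < ?N" using 2 by linarith+
        then show ?thesis by (simp add: sum.distrib)
      qed
      also have "?x $$ (i, n - j) = (if i + (j - 1) = n then 1 else 0)"
      proof -
        have "n - j < n" "i = n - j + 1 \<longleftrightarrow> i + (j - 1) = n" using 2 by linarith+
        then show ?thesis using ij by (simp add: reg_nilp_def)
      qed
      \<comment> \<open>For \<open>j = 1\<close> the term b e_n is sent to 0, which is why column 0
        of \<open>jordan_basis n b\<close> carries no \<open>b\<close>.\<close>
      also have "?x $$ (i, n + 1 - j) = (if j > 1 \<and> i + (j - 1) = n + 1 then 1 else 0)"
      proof (cases "j = 1")
        case True
        then show ?thesis using ij by (simp add: reg_nilp_def)
      next
        case False
        then have "n + 1 - j < n" "j > 1" "i = n + 1 - j + 1 \<longleftrightarrow> i + (j - 1) = n + 1"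
          using 2 by linarith+
        then show ?thesis using ij by (simp add: reg_nilp_def)
      qed
      also have "(if i + (j - 1) = n then 1 else 0) +
          (if j > 1 \<and> i + (j - 1) = n + 1 then 1 else 0) * b = ?g $$ (i, j - 1)"
      proof -
        obtain m where "j = Suc m" using 2 by (cases j) auto
        then show ?thesis using 2 ij by (auto simp: jordan_basis_def)
      qed
      finally show ?thesis using 2 by simp
    next
      case 3
      then have "(\<Sum>k<?N. ?x $$ (i, k) * ?g $$ (k, j)) = (\<Sum>k<?N. if k = j then ?x $$ (i, k) else 0)"
        using ij by (intro sum.cong) (simp_all add: jordan_basis_def)
      also have "\<dots> = ?x $$ (i, j)" using ij by simp
      also have "\<dots> = ?g $$ (i, j - 1)"
      \<comment> \<open>Here the chain passes from f_1 to e_0 + b e_1, which is column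
        \<open>n\<close>.\<close>
      proof (cases "j = n + 1")
        case True
        then show ?thesis using ij assms by (simp add: reg_nilp_def jordan_basis_def)
      next
        case False
        then show ?thesis using 3 ij by (simp add: reg_nilp_def jordan_basis_def)
      qed
      finally show ?thesis using 3 by simp
    qed
  qed
  \<comment> \<open>Truncated subtraction makes \<open>j - 1\<close> equal to 0 at
    \<open>j = 0\<close>; the inner conditional suppresses that term.\<close>
  also have "\<dots> = (\<Sum>k<?N. if k = j - 1 then (if j = 0 then 0 else ?g $$ (i, k)) else 0)"
    using ij by (subst sum.delta) auto
  also have "\<dots> = (\<Sum>k<?N. ?g $$ (i, k) * jordan_block ?N 0 $$ (k, j))"
    using ij by (intro sum.cong) auto
  also have "\<dots> = (?g * jordan_block ?N 0) $$ (i, j)"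
    using ij by (simp add: scalar_prod_def carrier_matD[OF jordan_basis_carrier] atLeast0LessThan)
  finally show "(?x * ?g) $$ (i, j) = (?g * jordan_block ?N 0) $$ (i, j)" .
qed (simp_all add: reg_nilp_def jordan_basis_def)

lemma reg_nilp_regular:
  assumes "n \<ge> 1"
  shows "(reg_nilp n b :: 'k::field mat) \<in> regular_nilpotent_orbit (2 * n + 1)"
proof -
  let ?N = "2 * n + 1" and ?g = "jordan_basis n b"
  note h = inv_GL[OF jordan_basis_in_GL[of n b]]
  have "conj_mat ?N ?g (jordan_block ?N 0) = reg_nilp n b * ?g * inv\<^bsub>GL ?N\<^esub> ?g"
    by (simp only: conj_mat_def reg_nilp_mult_jordan_basis[OF assms])
  also have "\<dots> = reg_nilp n b"
    using assoc_mult_mat[OF reg_nilp_carrier jordan_basis_carrier h(1)] h(2)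
      right_mult_one_mat[OF reg_nilp_carrier] by simp
  finally have "reg_nilp n b = conj_mat ?N ?g (jordan_block ?N 0)" ..
  then show ?thesis
    unfolding regular_nilpotent_orbit_def orbit_def using jordan_basis_in_GL[of n b] by blast
qed

text \<open>Powers commute with conjugation, and the \<open>N\<close>-th power of the Jordan block
  vanishes.\<close>

lemma regular_nilpotent_orbit_nilpotent:
  assumes "(x :: 'k::field mat) \<in> regular_nilpotent_orbit N"
  shows "nilpotent_mat N x"
proof -
  obtain g where gl: "g \<in> carrier (GL N)" and x: "x = conj_mat N g (jordan_block N 0)"
    using assms by (auto simp: regular_nilpotent_orbit_def orbit_def)
  note g = GL_carrier_mat[OF gl] and h = inv_GL[OF gl]
  have xc: "x \<in> carrier_mat N N" unfolding x conj_mat_def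
    by (rule mult_carrier_mat[OF mult_carrier_mat[OF g jordan_block_carrier] h(1)])
  then have "similar_mat_wit x (jordan_block N 0) g (inv\<^bsub>GL N\<^esub> g)"
    using g h x by (intro similar_mat_witI) (auto simp: conj_mat_def)
  then have "x ^\<^sub>m N = g * jordan_block N 0 ^\<^sub>m N * inv\<^bsub>GL N\<^esub> g"
    by (rule similar_mat_wit_pow_id)
  also have "jordan_block N (0 :: 'k) ^\<^sub>m N = 0\<^sub>m N N"
    unfolding jordan_block_zero_pow by (intro eq_matI) auto
  also have "g * 0\<^sub>m N N * inv\<^bsub>GL N\<^esub> g = 0\<^sub>m N N" using g h(1) by simp
  finally show ?thesis using xc by (auto simp: nilpotent_mat_def)
qed

section \<open>Separation of the family by the invariant\<close>

lemma reg_nilp_preimage: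
  assumes "CHAR('k::field) = 2" "n \<ge> 1"
  shows "\<exists>u \<in> carrier_vec (2 * n + 1).
    reg_nilp n b *\<^sub>v u = unit_vec (2 * n + 1) 0 \<and> u $ 0 = (b :: 'k)"
proof
  let ?N = "2 * n + 1"
  \<comment> \<open>This is f_1 + b e_0. Its image is e_0 + b e_1 + b e_1, and the last two terms
    cancel in characteristic 2.\<close>
  define u where "u = vec ?N (\<lambda>i. if i = 0 then b else if i = n + 1 then 1 else 0)"
  show uc: "u \<in> carrier_vec ?N" by (simp add: u_def)
  have "reg_nilp n b *\<^sub>v u = unit_vec ?N 0"
  proof (intro eq_vecI)
    fix i assume "i < dim_vec (unit_vec ?N 0 :: 'k vec)"
    then have i: "i < ?N" by simp
    have "(reg_nilp n b *\<^sub>v u) $ i = (\<Sum>k<?N. reg_nilp n b $$ (i, k) * u $ k)"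
      using i by (simp add: scalar_prod_def u_def carrier_matD[OF reg_nilp_carrier] atLeast0LessThan)
    also have "\<dots> = (\<Sum>k<?N. (if k = 0 then reg_nilp n b $$ (i, k) * b else 0) +
        (if k = n + 1 then reg_nilp n b $$ (i, k) else 0))"
      by (intro sum.cong) (auto simp: u_def)
    also have "\<dots> = reg_nilp n b $$ (i, 0) * b + reg_nilp n b $$ (i, n + 1)"
      using assms(2) by (simp add: sum.distrib numeral_2_eq_2)
    also have "\<dots> = unit_vec ?N 0 $ i"
      using i assms(2) add_self_CHAR_2[OF assms(1), of b] by (auto simp: reg_nilp_def)
    finally show "(reg_nilp n b *\<^sub>v u) $ i = unit_vec ?N 0 $ i" .
  qed (simp add: reg_nilp_def)
  then show "reg_nilp n b *\<^sub>v u = unit_vec ?N 0 \<and> u $ 0 = b" by (simp add: u_def)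
qed

text \<open>Equal orbits yield an element of \<open>H n\<close> conjugating one matrix to the other,
  so their invariants \<open>b\<close> and \<open>c\<close> agree.\<close>

lemma inj_orbit_reg_nilp:
  assumes "CHAR('k::field) = 2" "n \<ge> 1"
  shows "inj (\<lambda>b :: 'k. orbit (H n) (conj_mat (2 * n + 1)) (reg_nilp n b))"
proof (rule injI)
  let ?N = "2 * n + 1"
  fix b c :: 'k
  assume eq: "orbit (H n) (conj_mat ?N) (reg_nilp n b) = orbit (H n) (conj_mat ?N) (reg_nilp n c)"
  have "conj_mat ?N (1\<^sub>m ?N) (reg_nilp n c) = reg_nilp n c"
    by (simp add: conj_mat_def inv_GL_one left_mult_one_mat[OF reg_nilp_carrier_Suc]
        right_mult_one_mat[OF reg_nilp_carrier_Suc])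
  then have "reg_nilp n c \<in> orbit (H n) (conj_mat ?N) (reg_nilp n c)"
    unfolding orbit_def using one_in_H by force
  then obtain g where g: "g \<in> carrier (H n)" "reg_nilp n c = conj_mat ?N g (reg_nilp n b)"
    unfolding eq[symmetric] by (auto simp: orbit_def)
  obtain u v where "u \<in> carrier_vec ?N" "reg_nilp n b *\<^sub>v u = unit_vec ?N 0" "u $ 0 = b"
    and "v \<in> carrier_vec ?N" "reg_nilp n c *\<^sub>v v = unit_vec ?N 0" "v $ 0 = c"
    using reg_nilp_preimage[OF assms] by meson
  then show "b = c"
    using first_coordinate_of_preimage_invariant[OF assms(1) g(1) reg_nilp_carrier
        reg_nilp_in_g_theta[OF assms(2)] g(2)] by blast
qed

theorem proposition1p17:
  fixes n :: nat
  assumes "n \<ge> 1"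
    and "CHAR('k::alg_closed_field) = 2"
  shows "infinite (orbits (H n :: 'k mat monoid)
             (regular_nilpotent_orbit (2 * n + 1) \<inter> g_theta n) (conj_mat (2 * n + 1)))
       \<and> infinite (orbits (H n :: 'k mat monoid) (g_theta_nil n) (conj_mat (2 * n + 1)))"
proof -
  define F where "F = (\<lambda>b :: 'k. orbit (H n) (conj_mat (2 * n + 1)) (reg_nilp n b))"
  have inf: "infinite (range F)"
    using inj_orbit_reg_nilp[OF assms(2,1)] infinite_UNIV_alg_closed_field
    by (simp add: F_def finite_image_iff)
  have reg: "reg_nilp n b \<in> regular_nilpotent_orbit (2 * n + 1) \<inter> g_theta n" for b :: 'k
    using reg_nilp_regular reg_nilp_in_g_theta assms(1) by blast
  \<comment> \<open>The same family lies in both sets, so its infinitely many orbits settle both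
    claims.\<close>
  then have "reg_nilp n b \<in> g_theta_nil n" for b :: 'k
    using regular_nilpotent_orbit_nilpotent by (auto simp: g_theta_nil_def)
  with reg have "range F \<subseteq> orbits (H n) (regular_nilpotent_orbit (2 * n + 1) \<inter> g_theta n) (conj_mat (2 * n + 1))"
    "range F \<subseteq> orbits (H n) (g_theta_nil n) (conj_mat (2 * n + 1))"
    by (auto simp: orbits_def F_def)
  then show ?thesis using inf infinite_super by blast
qed

end
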